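(* For $X$ with density $h(x)\exp\{x\theta-\mathcal{A}(\theta)\}$ with respect to Lebesgue measure on $(-\infty,a)$, there exists for $\theta>0$ a unique unbiased estimator of $\frac{1}{\theta}$, and it is given by $$\delta_0(X)=\frac{1}{h(X)}\int_X^a h(s)\,ds .$$
   Context: The statistic $X\in\mathbb{R}$ has the one-parameter exponential family density $h(x)\exp\{x\theta-\mathcal{A}(\theta)\}$ with respect to Lebesgue measure on $(-\infty,a)$, where $a$ is either finite or $+\infty$, and $\theta$ ranges over the natural parameter space $\Theta=\{\theta\in\mathbb{R}:\int_{-\infty}^a h(x)\exp(x\theta)\,dx<\infty\}$. Here $\mathcal{A}(\theta)$ is the normalizing term, so that the density integrates to one. It is assumed that $\Theta$ contains an interval of the form $(0,\zeta)$. An estimator $\delta(X)$ is unbiased for $\frac1\theta$ for $\theta>0$ when $\mathbb{E}_\theta\{\delta(X)\}=\frac1\theta$ for all $\theta>0$ in $\Theta$, where $\mathbb{E}_\theta$ is expectation under the density with parameter $\theta$. Uniqueness is among functions of $X$, in the usual almost-sure sense.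
   Formalization: The function h is additionally assumed to be positive almost everywhere on (-∞,a); without this the claim fails, e.g. for h the indicator of (0,1) and a = 1, where δ₀(X) = 1 − X has expectation at most 1. *)

theory Defs
  imports "HOL-Probability.Probability"
begin

text \<open>
  The upper endpoint is an extended real, so that both finite endpoints and \<open>a = \<infinity>\<close> are
  covered.  All functions of the statistic matter only on \<open>(-\<infinity>, a)\<close>: measurability and
  expectations refer to Lebesgue measure restricted to this interval.
\<close>

definition lborel_below :: "ereal \<Rightarrow> real measure" where
  "lborel_below a = restrict_space lborel (einterval (-\<infinity>) a)"

definition natural_param_space :: "(real \<Rightarrow> real) \<Rightarrow> ereal \<Rightarrow> real set" where
  "natural_param_space h a =
     {\<theta>. (\<integral>\<^sup>+ x. ennreal (h x * exp (x * \<theta>)) \<partial>lborel_below a) < \<infinity>}"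

definition expfam_law :: "(real \<Rightarrow> real) \<Rightarrow> (real \<Rightarrow> real) \<Rightarrow> ereal \<Rightarrow> real \<Rightarrow> real measure" where
  "expfam_law h A a \<theta> = density (lborel_below a) (\<lambda>x. ennreal (h x * exp (x * \<theta> - A \<theta>)))"

text \<open>
  Integrability is required explicitly because the Bochner integral of a non-integrable
  function is \<open>0\<close> by convention.
\<close>

definition unbiased_for ::
    "(real \<Rightarrow> real) \<Rightarrow> (real \<Rightarrow> real) \<Rightarrow> ereal \<Rightarrow> real set \<Rightarrow> (real \<Rightarrow> real) \<Rightarrow> (real \<Rightarrow> real) \<Rightarrow> bool" where
  "unbiased_for h A a T g \<delta> \<longleftrightarrow>
     \<delta> \<in> borel_measurable (lborel_below a) \<and>
     (\<forall>\<theta>\<in>T. integrable (expfam_law h A a \<theta>) \<delta> \<and>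
             (\<integral>x. \<delta> x \<partial>expfam_law h A a \<theta>) = g \<theta>)"

text \<open>
  If some \<open>\<theta> > 0\<close> lies in the natural parameter space and \<open>h\<close> is nonnegative almost everywhere,
  the integral below converges for every \<open>x < a\<close>, since
  \<open>h s \<le> exp (- x * \<theta>) * (h s * exp (s * \<theta>))\<close> for almost every \<open>s > x\<close>.
\<close>

definition delta0 :: "(real \<Rightarrow> real) \<Rightarrow> ereal \<Rightarrow> real \<Rightarrow> real" where
  "delta0 h a x = 1 / h x * (LBINT s=ereal x..a. h s)"

end

theory Submission
  imports Defs "HOL-Complex_Analysis.Complex_Analysis" "HOL-Real_Asymp.Real_Asymp"
begin

text \<open>
  Unbiasedness is Tonelli's theorem: \<open>\<integral> (\<integral>\<^sub>x\<^sup>a h s ds) exp (x\<theta>) dx = \<integral> h s (\<integral>\<^bsub>-\<infinity>\<^esub>\<^sup>s exp (x\<theta>) dx) ds\<close>, and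
  the inner integral is \<open>exp (s\<theta>) / \<theta>\<close>.

  For uniqueness, if \<open>\<delta>\<close> is unbiased then the bilateral Laplace transform of
  \<open>f = h \<cdot> (\<delta> - \<delta>\<^sub>0)\<close> vanishes on \<open>(0, \<zeta>)\<close>.  It is holomorphic on the strip \<open>0 < Re z < \<zeta>\<close>, hence
  zero there, and on a vertical line this says that the Fourier transform of \<open>f x exp (x\<theta>)\<close>
  is zero.  Levy's uniqueness theorem, applied to the normalised positive and negative parts,
  gives \<open>f = 0\<close> almost everywhere.
\<close>

section \<open>Uniqueness for the Fourier transform of an integrable function\<close>

lemma fourier_zero_imp_AE_zero:
  fixes g :: "real \<Rightarrow> real"
  assumes int: "integrable lborel g"
    and zero: "\<And>t. (\<integral>x. complex_of_real (g x) * iexp (t * x) \<partial>lborel) = 0"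
  shows "AE x in lborel. g x = 0"
proof -
  define p n where "p x = max 0 (g x)" and "n x = max 0 (- g x)" for x
  have pn: "g x = p x - n x" "0 \<le> p x" "0 \<le> n x" for x
    by (auto simp: p_def n_def)
  have intp: "integrable lborel p" and intn: "integrable lborel n"
    unfolding p_def n_def using int by (auto intro!: integrable_max)
  note [measurable] = borel_measurable_integrable[OF intp] borel_measurable_integrable[OF intn]
  have cint: "integrable lborel (\<lambda>x. complex_of_real (u x) * iexp (t * x))"
    if u: "integrable lborel u" for u :: "real \<Rightarrow> real" and t
  proof (rule Bochner_Integration.integrable_bound[OF u])
    show "(\<lambda>x. complex_of_real (u x) * iexp (t * x)) \<in> borel_measurable lborel"
      using u by measurable
  qed (auto simp: norm_mult)
  have eq: "(\<integral>x. complex_of_real (p x) * iexp (t * x) \<partial>lborel) =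
            (\<integral>x. complex_of_real (n x) * iexp (t * x) \<partial>lborel)" for t
  proof -
    have "(\<integral>x. complex_of_real (p x) * iexp (t * x) - complex_of_real (n x) * iexp (t * x) \<partial>lborel) = 0"
      using zero[of t] by (simp add: pn(1) algebra_simps)
    then show ?thesis
      using cint[OF intp, of t] cint[OF intn, of t] by simp
  qed
  define c where "c = (\<integral>x. p x \<partial>lborel)"
  \<comment> \<open>Frequency 0 shows that both parts have the same mass, so one constant normalises
    both to probability densities.\<close>
  have cn: "c = (\<integral>x. n x \<partial>lborel)"
    using eq[of 0] by (simp add: c_def)
  have "c \<ge> 0" unfolding c_def by (simp add: pn)
  show ?thesis
  \<comment> \<open>Mass zero cannot be normalised, but then both nonnegative parts already vanish
    almost everywhere.\<close>
  proof (cases "c = 0")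
    case True
    have "AE x in lborel. p x = 0"
      using integral_nonneg_eq_0_iff_AE[OF intp] pn True c_def by auto
    moreover have "AE x in lborel. n x = 0"
      using integral_nonneg_eq_0_iff_AE[OF intn] pn True cn by auto
    ultimately show ?thesis
      by eventually_elim (simp add: pn(1))
  next
    case False
    with \<open>c \<ge> 0\<close> have c: "c > 0" by simp
    have dist: "real_distribution (density lborel (\<lambda>x. ennreal (u x / c)))"
      if u: "integrable lborel u" "\<And>x. 0 \<le> u x" "(\<integral>x. u x \<partial>lborel) = c" for u
    proof -
      have "(\<integral>\<^sup>+ x. ennreal (u x / c) \<partial>lborel) = ennreal (\<integral>x. u x / c \<partial>lborel)"
        using u c by (intro nn_integral_eq_integral) auto
      also have "\<dots> = 1" using u c by simp
      finally have 1: "(\<integral>\<^sup>+ x. ennreal (u x / c) \<partial>lborel) = 1" .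
      have [measurable]: "u \<in> borel_measurable borel"
        using borel_measurable_integrable[OF u(1)] by simp
      show ?thesis
        by (intro real_distribution.intro real_distribution_axioms.intro prob_spaceI)
           (simp_all add: emeasure_density 1)
    qed
    have chr: "char (density lborel (\<lambda>x. ennreal (u x / c))) t =
        (\<integral>x. complex_of_real (u x) * iexp (t * x) \<partial>lborel) / c"
      if u: "integrable lborel u" "\<And>x. 0 \<le> u x" for u t
    proof -
      have [measurable]: "u \<in> borel_measurable borel"
        using borel_measurable_integrable[OF u(1)] by simp
      have "char (density lborel (\<lambda>x. ennreal (u x / c))) t =
        (\<integral>x. (u x / c) *\<^sub>R iexp (t * x) \<partial>lborel)"
        unfolding char_def using u c by (intro integral_density) auto
      also have "\<dots> = (\<integral>x. (complex_of_real (u x) * iexp (t * x)) / c \<partial>lborel)"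
        by (simp add: scaleR_conv_of_real)
      finally show ?thesis by simp
    qed
    have "density lborel (\<lambda>x. ennreal (p x / c)) = density lborel (\<lambda>x. ennreal (n x / c))"
    proof (rule Levy_uniqueness)
      show "char (density lborel (\<lambda>x. ennreal (p x / c))) = char (density lborel (\<lambda>x. ennreal (n x / c)))"
        using eq pn intp intn by (auto simp: chr fun_eq_iff)
    qed (rule dist[OF intp pn(2) c_def[symmetric]] dist[OF intn pn(3) cn[symmetric]])+
    then have "AE x in lborel. ennreal (p x / c) = ennreal (n x / c)"
      by (subst (asm) sigma_finite_measure.density_unique_iff[OF sigma_finite_lborel]) auto
    then show ?thesis
    proof eventually_elim
      case (elim x)
      then have "p x / c = n x / c"
        using c pn by (subst (asm) ennreal_inj) auto
      then show ?case using c pn(1)[of x] by simp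
    qed
  qed
qed

section \<open>Uniqueness for the bilateral Laplace transform\<close>

text \<open>Around each point \<open>c\<close> of the strip, expanding
  \<open>exp (x * (w - c))\<close> and integrating term by term gives a convergent power series in
  \<open>w - c\<close>. Dominated convergence justifies the exchange.\<close>

lemma bilateral_laplace_holomorphic:
  fixes f :: "real \<Rightarrow> real"
  assumes meas[measurable]: "f \<in> borel_measurable borel"
    and int: "\<And>\<theta>. p < \<theta> \<Longrightarrow> \<theta> < q \<Longrightarrow> integrable lborel (\<lambda>x. f x * exp (x * \<theta>))"
  shows "(\<lambda>z. \<integral>x. complex_of_real (f x) * exp (of_real x * z) \<partial>lborel)
           analytic_on {z. p < Re z \<and> Re z < q}"
  unfolding analytic_on_def
proof safe
  let ?F = "\<lambda>z. \<integral>x. complex_of_real (f x) * exp (of_real x * z) \<partial>lborel"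
  fix c assume c: "p < Re c" "Re c < q"
  \<comment> \<open>The distance from \<open>c\<close> to the boundary of the strip, so that
    \<open>Re c + \<rho>\<close> and \<open>Re c - \<rho>\<close> stay in \<open>(p, q)\<close>
    whenever \<open>\<rho> < r\<close>.\<close>
  define r where "r = min (Re c - p) (q - Re c)"
  have "r > 0" using c by (simp add: r_def)
  define a where "a k = (\<integral>x. complex_of_real (f x) * exp (of_real x * c) * of_real x ^ k / fact k \<partial>lborel)" for k
  have "(\<lambda>k. a k * (w - c) ^ k) sums ?F w" if "w \<in> ball c r" for w
  proof -
    define \<rho> where "\<rho> = norm (w - c)"
    have \<rho>: "0 \<le> \<rho>" "\<rho> < r" using that by (auto simp: \<rho>_def dist_norm norm_minus_commute)
    \<comment> \<open>\<open>exp (\<bar>x\<bar> * \<rho>)\<close> equals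
      \<open>exp (x * \<rho>)\<close> or \<open>exp (- x * \<rho>)\<close> according to the sign of
      \<open>x\<close>. Adding both cases gives a majorant that is integrable by \<open>int\<close>
      at two real parameters.\<close>
    define D where "D x = \<bar>f x * exp (x * (Re c + \<rho>))\<bar> + \<bar>f x * exp (x * (Re c - \<rho>))\<bar>" for x
    have intD: "integrable lborel D"
      unfolding D_def using \<rho>
      by (intro Bochner_Integration.integrable_add integrable_abs int) (auto simp: r_def)
    define T where "T k x = complex_of_real (f x) * exp (of_real x * c) * (of_real x * (w - c)) ^ k / fact k" for k x
    have [measurable]: "T k \<in> borel_measurable borel" for k
      unfolding T_def by measurable
    have bnd: "\<bar>f x\<bar> * exp (x * Re c) * exp (\<bar>x\<bar> * \<rho>) \<le> D x" for x
    proof (cases "x \<ge> 0")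
      case True
      then have "\<bar>f x\<bar> * exp (x * Re c) * exp (\<bar>x\<bar> * \<rho>) = \<bar>f x * exp (x * (Re c + \<rho>))\<bar>"
        by (simp add: abs_mult exp_add[symmetric] algebra_simps)
      then show ?thesis by (simp add: D_def)
    next
      case False
      then have "\<bar>f x\<bar> * exp (x * Re c) * exp (\<bar>x\<bar> * \<rho>) = \<bar>f x * exp (x * (Re c - \<rho>))\<bar>"
        by (simp add: abs_mult exp_add[symmetric] algebra_simps)
      then show ?thesis by (simp add: D_def)
    qed
    have normT: "norm (T k x) = \<bar>f x\<bar> * exp (x * Re c) * ((\<bar>x\<bar> * \<rho>) ^ k / fact k)" for k x
      by (simp add: T_def norm_mult norm_divide norm_power \<rho>_def)
    have expsum: "(\<lambda>k. y ^ k / fact k) sums exp y" for y :: "'a :: {real_normed_field,banach}"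
      using exp_converges[of y] by (simp add: scaleR_conv_of_real divide_inverse mult.commute)
    \<comment> \<open>One bound on the sums of norms serves twice: it makes each term integrable and
      dominates all partial sums uniformly in \<open>n\<close>.\<close>
    have partial: "(\<Sum>k<n. norm (T k x)) \<le> D x" for n x
    proof -
      have "(\<Sum>k<n. (\<bar>x\<bar> * \<rho>) ^ k / fact k) \<le> exp (\<bar>x\<bar> * \<rho>)"
        using expsum[of "\<bar>x\<bar> * \<rho>"] \<rho>
        by (intro order.trans[OF sum_le_suminf]) (auto simp: sums_iff)
      then have "(\<Sum>k<n. norm (T k x)) \<le> \<bar>f x\<bar> * exp (x * Re c) * exp (\<bar>x\<bar> * \<rho>)"
        unfolding normT sum_distrib_left[symmetric] by (intro mult_left_mono) auto
      then show ?thesis using bnd[of x] by linarith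
    qed
    have intT: "integrable lborel (T k)" for k
    proof (rule Bochner_Integration.integrable_bound[OF intD])
      show "AE x in lborel. norm (T k x) \<le> norm (D x)"
      proof (intro AE_I2)
        fix x
        have "norm (T k x) \<le> (\<Sum>k<Suc k. norm (T k x))" by (simp add: sum_nonneg)
        also have "\<dots> \<le> D x" by (rule partial)
        finally show "norm (T k x) \<le> norm (D x)" by simp
      qed
    qed auto
    have "(\<lambda>n. \<integral>x. (\<Sum>k<n. T k x) \<partial>lborel) \<longlonglongrightarrow> ?F w"
    proof (rule integral_dominated_convergence[where w = D])
      show "AE x in lborel. (\<lambda>n. \<Sum>k<n. T k x) \<longlonglongrightarrow> complex_of_real (f x) * exp (of_real x * w)"
      proof (intro AE_I2)
        fix x :: real
        have "(\<lambda>k. complex_of_real (f x) * exp (of_real x * c) * ((of_real x * (w - c)) ^ k / fact k)) sums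
              (complex_of_real (f x) * exp (of_real x * c) * exp (of_real x * (w - c)))"
          by (intro sums_mult expsum)
        also have "complex_of_real (f x) * exp (of_real x * c) * exp (of_real x * (w - c)) =
            complex_of_real (f x) * exp (of_real x * w)"
          by (simp add: mult.assoc exp_add[symmetric] algebra_simps)
        finally show "(\<lambda>n. \<Sum>k<n. T k x) \<longlonglongrightarrow> complex_of_real (f x) * exp (of_real x * w)"
          by (simp add: sums_def T_def)
      qed
      show "AE x in lborel. norm (\<Sum>k<n. T k x) \<le> D x" for n
        using order.trans[OF norm_sum partial] by auto
    qed (use intD in auto)
    also have "(\<lambda>n. \<integral>x. (\<Sum>k<n. T k x) \<partial>lborel) = (\<lambda>n. \<Sum>k<n. \<integral>x. T k x \<partial>lborel)"
      using intT by (simp add: Bochner_Integration.integral_sum)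
    also have "(\<lambda>n. \<Sum>k<n. \<integral>x. T k x \<partial>lborel) = (\<lambda>n. \<Sum>k<n. a k * (w - c) ^ k)"
    proof -
      have "(\<integral>x. T k x \<partial>lborel) = a k * (w - c) ^ k" for k
        unfolding a_def T_def
        by (subst integral_mult_left_zero[symmetric]) (simp add: power_mult_distrib mult_ac)
      then show ?thesis by simp
    qed
    finally show ?thesis by (simp add: sums_def)
  qed
  then have "?F holomorphic_on ball c r"
    by (rule power_series_holomorphic)
  then show "\<exists>\<epsilon>>0. ?F holomorphic_on ball c \<epsilon>" using \<open>r > 0\<close> by blast
qed

lemma bilateral_laplace_unique:
  fixes f :: "real \<Rightarrow> real"
  assumes meas[measurable]: "f \<in> borel_measurable borel"
    and "p < q"
    and int: "\<And>\<theta>. p < \<theta> \<Longrightarrow> \<theta> < q \<Longrightarrow> integrable lborel (\<lambda>x. f x * exp (x * \<theta>))"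
    and zero: "\<And>\<theta>. p < \<theta> \<Longrightarrow> \<theta> < q \<Longrightarrow> (\<integral>x. f x * exp (x * \<theta>) \<partial>lborel) = 0"
  shows "AE x in lborel. f x = 0"
proof -
  define F where "F z = (\<integral>x. complex_of_real (f x) * exp (of_real x * z) \<partial>lborel)" for z
  define S where "S = {z. p < Re z \<and> Re z < q}"
  have S: "open S" "connected S"
    unfolding S_def Collect_conj_eq
    by (auto intro!: open_Int open_halfspace_Re_gt open_halfspace_Re_lt convex_connected convex_Int
        convex_halfspace_Re_gt convex_halfspace_Re_lt)
  have "F analytic_on S"
    unfolding F_def S_def using bilateral_laplace_holomorphic[OF meas int] by simp
  then have hol: "F holomorphic_on S" by (rule analytic_imp_holomorphic)
  define \<theta>0 where "\<theta>0 = (p + q) / 2"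
  have \<theta>0: "p < \<theta>0" "\<theta>0 < q" using \<open>p < q\<close> by (auto simp: \<theta>0_def field_simps)
  have real: "F (of_real \<theta>) = 0" if "p < \<theta>" "\<theta> < q" for \<theta>
  proof -
    have "F (of_real \<theta>) = (\<integral>x. complex_of_real (f x * exp (x * \<theta>)) \<partial>lborel)"
      by (simp add: F_def exp_of_real[symmetric])
    then show ?thesis using zero[OF that] by (simp only: integral_complex_of_real) simp
  qed
  \<comment> \<open>The identity theorem needs zeros that accumulate inside the strip; the midpoint
    of the real interval is such a point.\<close>
  have lim: "complex_of_real \<theta>0 islimpt (complex_of_real ` {p<..<q})"
  proof (rule islimpt_approachable[THEN iffD2], safe)
    fix e :: real assume "e > 0"
    \<comment> \<open>A point to the right of \<open>\<theta>0\<close>, at distance at most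
      \<open>e / 2\<close>, and no further than halfway to \<open>q\<close>, hence still inside the
      interval.\<close>
    define y where "y = min (\<theta>0 + e / 2) ((\<theta>0 + q) / 2)"
    have "y \<in> {p<..<q}" "y \<noteq> \<theta>0" "\<bar>y - \<theta>0\<bar> < e"
      using \<open>e > 0\<close> \<theta>0 by (auto simp: y_def min_def field_simps)
    then show "\<exists>x'\<in>complex_of_real ` {p<..<q}. x' \<noteq> complex_of_real \<theta>0 \<and> dist x' (complex_of_real \<theta>0) < e"
      by (intro bexI[of _ "of_real y"]) (auto simp: dist_real_def)
  qed
  have strip: "F z = 0" if "z \<in> S" for z
    by (rule analytic_continuation[OF hol S _ _ lim _ that])
       (use \<theta>0 real in \<open>auto simp: S_def\<close>)
  have "AE x in lborel. f x * exp (x * \<theta>0) = 0"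
  proof (rule fourier_zero_imp_AE_zero[OF int[OF \<theta>0]])
    fix t
    \<comment> \<open>On the vertical line through \<open>\<theta>0\<close> the Laplace transform of
      \<open>f\<close> is the Fourier transform of the tilted function
      \<open>f x * exp (x * \<theta>0)\<close>.\<close>
    have "complex_of_real (f x * exp (x * \<theta>0)) * iexp (t * x) =
        complex_of_real (f x) * exp (of_real x * Complex \<theta>0 t)" for x
      by (simp add: exp_of_real[symmetric] exp_add[symmetric] mult.assoc complex_eq algebra_simps Complex_eq)
    then have "(\<integral>x. complex_of_real (f x * exp (x * \<theta>0)) * iexp (t * x) \<partial>lborel) = F (Complex \<theta>0 t)"
      by (simp only: F_def)
    also have "\<dots> = 0" using \<theta>0 by (intro strip) (simp add: S_def)
    finally show "(\<integral>x. complex_of_real (f x * exp (x * \<theta>0)) * iexp (t * x) \<partial>lborel) = 0" .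
  qed
  then show ?thesis by simp
qed

section \<open>An exponential integral over a lower half-line\<close>

text \<open>This is the inner integral left by Tonelli's theorem, with \<open>b\<close> standing for
  \<open>A \<theta>\<close>. The reflection of \<open>x\<close> to \<open>s - x\<close> moves it to
  an upper half-line, where the fundamental theorem of calculus applies.\<close>

lemma nn_integral_exp_lessThan:
  fixes \<theta> b s :: real
  assumes "\<theta> > 0"
  shows "(\<integral>\<^sup>+ x. ennreal (exp (x * \<theta> - b)) * indicator {..<s} x \<partial>lborel) = ennreal (exp (s * \<theta> - b) / \<theta>)"
proof -
  have "(\<integral>\<^sup>+ x. ennreal (exp (x * \<theta> - b)) * indicator {..<s} x \<partial>lborel) =
      (\<integral>\<^sup>+ x. ennreal (exp ((s - x) * \<theta> - b)) * indicator {..<s} (s - x) \<partial>lborel)"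
    by (subst nn_integral_real_affine[where c = "-1" and t = s]) auto
  also have "\<dots> = (\<integral>\<^sup>+ x. ennreal (exp ((s - x) * \<theta> - b)) * indicator {0..} x \<partial>lborel)"
  proof (rule nn_integral_cong_AE)
    \<comment> \<open>The reflected half-line is open at 0 and the target is closed; they differ by
      a null set.\<close>
    show "AE x in lborel. ennreal (exp ((s - x) * \<theta> - b)) * indicator {..<s} (s - x) =
        ennreal (exp ((s - x) * \<theta> - b)) * indicator {0..} x"
      using AE_lborel_singleton[of "0::real"]
      by eventually_elim (auto split: split_indicator)
  qed
  also have "\<dots> = ennreal (0 - (- exp ((s - 0) * \<theta> - b) / \<theta>))"
  proof (rule nn_integral_FTC_atLeast)
    show "((\<lambda>x. - exp ((s - x) * \<theta> - b) / \<theta>) has_real_derivative exp ((s - x) * \<theta> - b)) (at x)" for x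
      using assms by (auto intro!: derivative_eq_intros)
    show "((\<lambda>x. - exp ((s - x) * \<theta> - b) / \<theta>) \<longlongrightarrow> 0) at_top"
      using assms by real_asymp
  qed auto
  finally show ?thesis by simp
qed

section \<open>The exponential family and the tail integral of its carrier\<close>

text \<open>\<open>A\<close> is an arbitrary function here; \<open>prob\<close> makes it the
  log-normaliser at each natural parameter.\<close>

locale expfam_below =
  fixes h A :: "real \<Rightarrow> real" and a :: ereal
  assumes h_meas[measurable]: "h \<in> borel_measurable (lborel_below a)"
    and h_pos: "AE x in lborel_below a. h x > 0"
    and prob: "\<And>\<theta>. \<theta> \<in> natural_param_space h a \<Longrightarrow> prob_space (expfam_law h A a \<theta>)"
begin

abbreviation I :: "real set" where "I \<equiv> einterval (-\<infinity>) a"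

text \<open>The hypotheses control \<open>h\<close> only almost everywhere on \<open>I\<close>; \<open>h0\<close> is a nonnegative Borel
  version of it that vanishes off \<open>I\<close>.\<close>

definition h0 :: "real \<Rightarrow> real" where "h0 x = (if x \<in> I \<and> h x > 0 then h x else 0)"

text \<open>The numerator of \<open>delta0\<close>. Since \<open>h0\<close> vanishes off
  \<open>I\<close>, the endpoint \<open>a\<close> disappears and the integral runs over a full
  half-line.\<close>

definition tail :: "real \<Rightarrow> real" where "tail x = (\<integral>s. h0 s * indicator {x<..} s \<partial>lborel)"

lemma h0_nonneg: "0 \<le> h0 x"
  by (simp add: h0_def)

lemma tail_nonneg: "0 \<le> tail x"
  by (simp add: tail_def h0_nonneg)

lemma measurable_below_iff:
  "f \<in> borel_measurable (lborel_below a) \<longleftrightarrow> (\<lambda>x. indicator I x *\<^sub>R f x) \<in> borel_measurable borel"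
  for f :: "real \<Rightarrow> real"
  unfolding lborel_below_def by (subst borel_measurable_restrict_space_iff) auto

lemma h0_measurable[measurable]: "h0 \<in> borel_measurable borel"
proof -
  have "(\<lambda>x. max 0 (indicator I x *\<^sub>R h x)) \<in> borel_measurable borel"
    using h_meas[unfolded measurable_below_iff] by measurable
  also have "(\<lambda>x. max 0 (indicator I x *\<^sub>R h x)) = h0"
    by (auto simp: h0_def fun_eq_iff split: split_indicator)
  finally show ?thesis .
qed

lemma below_measurableI: "f \<in> borel_measurable borel \<Longrightarrow> f \<in> borel_measurable (lborel_below a)"
  unfolding lborel_below_def by (rule measurable_restrict_space1) simp

lemma tail_measurable[measurable]: "tail \<in> borel_measurable borel"
proof -
  \<comment> \<open>The range of integration depends on \<open>x\<close>; writing it as a section of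
    a fixed set of pairs makes the integrand jointly measurable.\<close>
  have "(\<lambda>x. \<integral>s. h0 s * indicator {p. fst p < snd p} (x, s) \<partial>lborel) \<in> borel_measurable borel"
    by measurable
  then show ?thesis
    by (simp add: tail_def[abs_def] indicator_def greaterThan_def)
qed

lemma AE_below_iff: "(AE x in lborel_below a. P x) \<longleftrightarrow> (AE x in lborel. x \<in> I \<longrightarrow> P x)"
  unfolding lborel_below_def by (subst AE_restrict_space_iff) auto

lemma h_eq_h0: "AE x in lborel_below a. h x = h0 x"
  using h_pos unfolding AE_below_iff by eventually_elim (auto simp: h0_def)

lemma nn_integral_below:
  "(\<integral>\<^sup>+ x. f x \<partial>lborel_below a) = (\<integral>\<^sup>+ x. f x * indicator I x \<partial>lborel)"
  unfolding lborel_below_def by (subst nn_integral_restrict_space) auto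

lemma h0_outside: "x \<notin> I \<Longrightarrow> h0 x = 0"
  by (simp add: h0_def)

lemma nn_integral_density_h0:
  assumes "\<And>x. 0 \<le> w x"
  shows "(\<integral>\<^sup>+ x. ennreal (h x * w x) \<partial>lborel_below a) = (\<integral>\<^sup>+ x. ennreal (h0 x * w x) \<partial>lborel)"
  unfolding nn_integral_below
  using h_eq_h0 unfolding AE_below_iff
  by (intro nn_integral_cong_AE, eventually_elim) (auto simp: h0_outside split: split_indicator)

lemma integrable_h0_exp:
  assumes "\<theta> \<in> natural_param_space h a"
  shows "integrable lborel (\<lambda>x. h0 x * exp (x * \<theta>))"
  using assms nn_integral_density_h0[of "\<lambda>x. exp (x * \<theta>)"]
  by (intro integrableI_nonneg) (auto simp: natural_param_space_def h0_nonneg)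

text \<open>For \<open>s > x\<close> and positive \<open>\<theta>\<close> the factor
  \<open>exp ((s - x) * \<theta>)\<close> is at least 1, so tilting dominates the tail. Thus
  \<open>tail\<close> is a genuine integral, not the default value 0 of a divergent one.\<close>

lemma integrable_h0_tail:
  assumes "\<theta> \<in> natural_param_space h a" "\<theta> > 0"
  shows "integrable lborel (\<lambda>s. h0 s * indicator {x<..} s)"
proof (rule Bochner_Integration.integrable_bound)
  show "integrable lborel (\<lambda>s. exp (- x * \<theta>) * (h0 s * exp (s * \<theta>)))"
    using integrable_h0_exp[OF assms(1)] by simp
  have "h0 s * indicator {x<..} s \<le> exp (- x * \<theta>) * (h0 s * exp (s * \<theta>))" for s
  proof (cases "x < s")
    case True
    have "1 \<le> exp (- x * \<theta>) * exp (s * \<theta>)"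
      using True assms(2) by (simp add: exp_add[symmetric])
    from mult_left_mono[OF this h0_nonneg[of s]] True show ?thesis
      by (simp add: mult_ac)
  qed (simp add: h0_nonneg)
  then show "AE s in lborel. norm (h0 s * indicator {x<..} s) \<le> norm (exp (- x * \<theta>) * (h0 s * exp (s * \<theta>)))"
    by (auto simp: h0_nonneg abs_mult)
qed measurable

text \<open>The equality is pointwise on \<open>I\<close>: replacing \<open>h\<close> by
  \<open>h0\<close> under the integral costs only a null set, and the denominator keeps
  \<open>h\<close> itself.\<close>

lemma delta0_eq:
  assumes "x \<in> I"
  shows "delta0 h a x = tail x / h x"
proof -
  have "ereal x < a" using assms by (simp add: einterval_def)
  have sub: "einterval x a \<subseteq> I" by (auto simp: einterval_def)
  have "(LBINT s=ereal x..a. h s) = (\<integral>s. indicator (einterval x a) s *\<^sub>R h s \<partial>lborel)"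
    using \<open>ereal x < a\<close> by (simp add: interval_lebesgue_integral_def set_lebesgue_integral_def)
  also have "\<dots> = tail x"
    unfolding tail_def
  proof (rule integral_cong_AE)
    have "(\<lambda>s. indicator (einterval x a) s * (indicator I s *\<^sub>R h s)) \<in> borel_measurable borel"
      using h_meas[unfolded measurable_below_iff] by measurable
    also have "(\<lambda>s. indicator (einterval x a) s * (indicator I s *\<^sub>R h s)) =
        (\<lambda>s. indicator (einterval x a) s *\<^sub>R h s)"
      using sub by (auto simp: fun_eq_iff split: split_indicator)
    finally show "(\<lambda>s. indicator (einterval x a) s *\<^sub>R h s) \<in> borel_measurable lborel" by simp
    show "AE s in lborel. indicator (einterval x a) s *\<^sub>R h s = h0 s * indicator {x<..} s"
      using h_eq_h0 unfolding AE_below_iff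
      by eventually_elim (auto simp: h0_outside einterval_def split: split_indicator)
  qed measurable
  finally show ?thesis by (simp add: delta0_def)
qed

lemma delta0_measurable[measurable]: "delta0 h a \<in> borel_measurable (lborel_below a)"
proof -
  note [measurable] = below_measurableI[OF tail_measurable]
  have "(\<lambda>x. tail x / h x) \<in> borel_measurable (lborel_below a)" by measurable
  moreover have "delta0 h a x = tail x / h x" if "x \<in> space (lborel_below a)" for x
    using that by (intro delta0_eq) (auto simp: lborel_below_def space_restrict_space)
  ultimately show ?thesis by (subst measurable_cong) auto
qed

lemma tail_outside: "x \<notin> I \<Longrightarrow> tail x = 0"
proof -
  assume x: "x \<notin> I"
  have "h0 s * indicator {x<..} s = 0" for s
  proof (cases "x < s")
    case True
    with x have "s \<notin> I" by (auto simp: einterval_def not_less intro: order.trans less_imp_le)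
    then show ?thesis by (simp add: h0_outside)
  qed simp
  then show ?thesis unfolding tail_def by (simp only: integral_zero)
qed

lemma exp_measurable[measurable]: "(\<lambda>x. exp (x * \<theta> - b)) \<in> borel_measurable (lborel_below a)"
  for \<theta> b :: real
  by (rule below_measurableI) measurable

section \<open>Unbiasedness of the estimator\<close>

lemma nn_integral_delta0:
  assumes \<theta>: "\<theta> \<in> natural_param_space h a" "\<theta> > 0"
  shows "(\<integral>\<^sup>+ x. ennreal (delta0 h a x) \<partial>expfam_law h A a \<theta>) = ennreal (1 / \<theta>)"
proof -
  let ?e = "\<lambda>x. exp (x * \<theta> - A \<theta>)"
  interpret P: prob_space "expfam_law h A a \<theta>" by (rule prob[OF \<theta>(1)])
  have "(\<integral>\<^sup>+ x. ennreal (delta0 h a x) \<partial>expfam_law h A a \<theta>) =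
      (\<integral>\<^sup>+ x. ennreal (h x * ?e x) * ennreal (delta0 h a x) \<partial>lborel_below a)"
    unfolding expfam_law_def by (rule nn_integral_density) measurable
  \<comment> \<open>The factor \<open>h x\<close> of the density cancels the denominator of
    \<open>delta0\<close>. Off \<open>I\<close> both sides vanish, so the integral extends to the
    whole line.\<close>
  also have "\<dots> = (\<integral>\<^sup>+ x. ennreal (tail x) * ennreal (?e x) \<partial>lborel)"
    unfolding nn_integral_below
  proof (rule nn_integral_cong_AE)
    show "AE x in lborel. ennreal (h x * ?e x) * ennreal (delta0 h a x) * indicator I x =
        ennreal (tail x) * ennreal (?e x)"
      using h_pos unfolding AE_below_iff
    proof eventually_elim
      case (elim x)
      then show ?case
        by (cases "x \<in> I")
           (simp_all add: tail_outside delta0_eq ennreal_mult'[symmetric] tail_nonneg mult.commute)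
    qed
  qed
  also have "\<dots> = (\<integral>\<^sup>+ x. \<integral>\<^sup>+ s. ennreal (h0 s) * (ennreal (?e x) * indicator {p. fst p < snd p} (x, s)) \<partial>lborel \<partial>lborel)"
  proof (rule nn_integral_cong)
    fix x :: real
    have "ennreal (tail x) = (\<integral>\<^sup>+ s. ennreal (h0 s * indicator {x<..} s) \<partial>lborel)"
      unfolding tail_def using integrable_h0_tail[OF \<theta>]
      by (intro nn_integral_eq_integral[symmetric]) (auto simp: h0_nonneg)
    then have "ennreal (tail x) * ennreal (?e x) =
        (\<integral>\<^sup>+ s. ennreal (h0 s * indicator {x<..} s) * ennreal (?e x) \<partial>lborel)"
      by (simp add: nn_integral_multc)
    also have "\<dots> = (\<integral>\<^sup>+ s. ennreal (h0 s) * (ennreal (?e x) * indicator {p. fst p < snd p} (x, s)) \<partial>lborel)"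
      by (intro nn_integral_cong) (auto split: split_indicator)
    finally show "ennreal (tail x) * ennreal (?e x) = \<dots>" .
  qed
  also have "\<dots> = (\<integral>\<^sup>+ s. \<integral>\<^sup>+ x. ennreal (h0 s) * (ennreal (?e x) * indicator {p. fst p < snd p} (x, s)) \<partial>lborel \<partial>lborel)"
    by (rule lborel_pair.Fubini') measurable
  also have "\<dots> = (\<integral>\<^sup>+ s. ennreal (h0 s * ?e s) * ennreal (1 / \<theta>) \<partial>lborel)"
  proof (rule nn_integral_cong)
    fix s :: real
    have "(\<integral>\<^sup>+ x. ennreal (h0 s) * (ennreal (?e x) * indicator {p. fst p < snd p} (x, s)) \<partial>lborel) =
        ennreal (h0 s) * (\<integral>\<^sup>+ x. ennreal (?e x) * indicator {..<s} x \<partial>lborel)"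
      by (subst nn_integral_cmult[symmetric]) (auto intro!: nn_integral_cong split: split_indicator)
    also have "\<dots> = ennreal (h0 s * ?e s) * ennreal (1 / \<theta>)"
      using \<theta>(2) by (simp add: nn_integral_exp_lessThan ennreal_mult'[symmetric] h0_nonneg)
    finally show "(\<integral>\<^sup>+ x. ennreal (h0 s) * (ennreal (?e x) * indicator {p. fst p < snd p} (x, s)) \<partial>lborel) = \<dots>" .
  qed
  also have "\<dots> = (\<integral>\<^sup>+ s. ennreal (h s * ?e s) \<partial>lborel_below a) * ennreal (1 / \<theta>)"
    by (simp add: nn_integral_multc nn_integral_density_h0)
  \<comment> \<open>What remains besides \<open>1 / \<theta>\<close> is the total mass of the
    law.\<close>
  also have "(\<integral>\<^sup>+ s. ennreal (h s * ?e s) \<partial>lborel_below a) = 1"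
    using P.emeasure_space_1 by (simp add: expfam_law_def emeasure_density cong: nn_integral_cong)
  finally show ?thesis by simp
qed

text \<open>As \<open>delta0\<close> is nonnegative almost everywhere, its finite nonnegative
  integral gives both integrability and the expectation.\<close>

lemma delta0_unbiased:
  "unbiased_for h A a {\<theta> \<in> natural_param_space h a. \<theta> > 0} (\<lambda>\<theta>. 1 / \<theta>) (delta0 h a)"
proof -
  have "has_bochner_integral (expfam_law h A a \<theta>) (delta0 h a) (1 / \<theta>)"
    if "\<theta> \<in> natural_param_space h a" "\<theta> > 0" for \<theta>
  proof (rule has_bochner_integral_nn_integral)
    show "delta0 h a \<in> borel_measurable (expfam_law h A a \<theta>)"
      using delta0_measurable by (simp add: expfam_law_def)
    have "AE x in lborel_below a. 0 \<le> delta0 h a x"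
      using h_pos unfolding AE_below_iff
      by eventually_elim (auto simp: delta0_eq tail_nonneg)
    then show "AE x in expfam_law h A a \<theta>. 0 \<le> delta0 h a x"
      unfolding expfam_law_def by (subst AE_density) auto
  qed (use that in \<open>simp_all add: nn_integral_delta0\<close>)
  then show ?thesis
    by (auto simp: unbiased_for_def has_bochner_integral_iff)
qed

section \<open>Uniqueness of the estimator\<close>

lemma unbiased_unique:
  assumes \<zeta>: "\<zeta> > 0" "{0<..<\<zeta>} \<subseteq> natural_param_space h a"
    and \<delta>: "unbiased_for h A a {\<theta> \<in> natural_param_space h a. \<theta> > 0} (\<lambda>\<theta>. 1 / \<theta>) \<delta>"
  shows "AE x in lborel_below a. \<delta> x = delta0 h a x"
proof -
  let ?d = "\<lambda>x. \<delta> x - delta0 h a x"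
  \<comment> \<open>Extension by zero turns the expectations of the difference into bilateral
    Laplace integrals over the whole line.\<close>
  define f where "f x = indicator I x *\<^sub>R (h x * ?d x)" for x
  have \<delta>_meas[measurable]: "\<delta> \<in> borel_measurable (lborel_below a)"
    using \<delta> by (simp add: unbiased_for_def)
  have "(\<lambda>x. h x * ?d x) \<in> borel_measurable (lborel_below a)" by measurable
  then have f_meas: "f \<in> borel_measurable borel"
    unfolding f_def measurable_below_iff .
  have transform: "has_bochner_integral lborel (\<lambda>x. f x * exp (x * \<theta>)) 0"
    if "0 < \<theta>" "\<theta> < \<zeta>" for \<theta>
  proof -
    let ?e = "\<lambda>x. exp (x * \<theta> - A \<theta>)"
    have \<theta>: "\<theta> \<in> {\<theta> \<in> natural_param_space h a. \<theta> > 0}" using that \<zeta> by auto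
    have nonneg: "AE x in lborel_below a. 0 \<le> h x * ?e x"
      using h_pos by eventually_elim simp
    have "has_bochner_integral (expfam_law h A a \<theta>) ?d (1 / \<theta> - 1 / \<theta>)"
      using \<delta> delta0_unbiased \<theta> unfolding unbiased_for_def has_bochner_integral_iff by auto
    then have "has_bochner_integral (expfam_law h A a \<theta>) ?d 0" by simp
    then have "has_bochner_integral (lborel_below a) (\<lambda>x. (h x * ?e x) *\<^sub>R ?d x) 0"
      unfolding expfam_law_def has_bochner_integral_iff
      using nonneg by (simp add: integrable_density integral_density)
    then have "has_bochner_integral lborel (\<lambda>x. indicator I x *\<^sub>R (h x * ?e x) *\<^sub>R ?d x) 0"
      unfolding lborel_below_def has_bochner_integral_iff
      by (simp add: integrable_restrict_space integral_restrict_space)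
    \<comment> \<open>Multiplying by \<open>exp (A \<theta>)\<close> removes the normaliser, so that
      the same \<open>f\<close>, free of \<open>\<theta>\<close>, serves every parameter.\<close>
    then have "has_bochner_integral lborel
        (\<lambda>x. exp (A \<theta>) * (indicator I x *\<^sub>R (h x * ?e x) *\<^sub>R ?d x)) (exp (A \<theta>) * 0)"
      by (rule has_bochner_integral_mult_right)
    also have "(\<lambda>x. exp (A \<theta>) * (indicator I x *\<^sub>R (h x * ?e x) *\<^sub>R ?d x)) = (\<lambda>x. f x * exp (x * \<theta>))"
      by (auto simp: f_def fun_eq_iff exp_diff)
    finally show ?thesis by simp
  qed
  have "AE x in lborel. f x = 0"
    by (rule bilateral_laplace_unique[OF f_meas \<zeta>(1)])
       (use transform in \<open>auto simp: has_bochner_integral_iff\<close>)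
  \<comment> \<open>Positivity of \<open>h\<close> almost everywhere on \<open>I\<close> lets the
    factor \<open>h x\<close> be cancelled from \<open>f x = 0\<close>.\<close>
  then show ?thesis
    using h_pos unfolding AE_below_iff
    by eventually_elim (auto simp: f_def)
qed

end

theorem proposition1:
  fixes h A :: "real \<Rightarrow> real" and a :: ereal and \<zeta> :: real
  assumes "a \<noteq> -\<infinity>"
    and "h \<in> borel_measurable (lborel_below a)"
    and "AE x in lborel_below a. h x > 0"
    and "\<And>\<theta>. \<theta> \<in> natural_param_space h a \<Longrightarrow> prob_space (expfam_law h A a \<theta>)"
    and "\<zeta> > 0" and "{0<..<\<zeta>} \<subseteq> natural_param_space h a"
  shows "unbiased_for h A a {\<theta> \<in> natural_param_space h a. \<theta> > 0} (\<lambda>\<theta>. 1 / \<theta>) (delta0 h a) \<and>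
    (\<forall>\<delta>. unbiased_for h A a {\<theta> \<in> natural_param_space h a. \<theta> > 0} (\<lambda>\<theta>. 1 / \<theta>) \<delta> \<longrightarrow>
       (\<forall>\<theta> \<in> natural_param_space h a. AE x in expfam_law h A a \<theta>. \<delta> x = delta0 h a x))"
proof -
  interpret expfam_below h A a
    using assms(2-4) by (rule expfam_below.intro)
  \<comment> \<open>The law has a density with respect to \<open>lborel_below a\<close>, so equality
    almost everywhere for the base measure passes to it.\<close>
  have "AE x in expfam_law h A a \<theta>. \<delta> x = delta0 h a x"
    if "unbiased_for h A a {\<theta> \<in> natural_param_space h a. \<theta> > 0} (\<lambda>\<theta>. 1 / \<theta>) \<delta>" for \<delta> \<theta>
  proof -
    have [measurable]: "(\<lambda>x. ennreal (h x * exp (x * \<theta> - A \<theta>))) \<in> borel_measurable (lborel_below a)"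
      by measurable
    show ?thesis
      using unbiased_unique[OF assms(5,6) that]
      unfolding expfam_law_def by (subst AE_density) auto
  qed
  with delta0_unbiased show ?thesis by blast
qed

end
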